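(* Let $K_{n,m}$ denote the complete bipartite graph with parts of sizes $n$ and $m$, where $n,m\in\mathbb{N}$. (i) For every $n\neq m$, $\max\{n,m\}\leq \chi'^t_d(K_{n,m})\leq m+n-1$. (ii) For every $n\in\mathbb{N}$, $n\leq \chi'^t_d(K_{n,n})\leq 2n$.
   Context: Graphs are simple. Two edges are adjacent if they are distinct and share an endpoint. A total dominator edge coloring (TDE-coloring) of a graph $G$ is a proper edge coloring of $G$ in which each edge of $G$ is adjacent to every edge of some color class (a color class is the set of all edges assigned a given used color). The total dominator edge chromatic number $\chi'^t_d(G)$ is the minimum number of color classes in a TDE-coloring of $G$.
   Formalization: Both parts have n, m at least 1 (with an empty part the lower bound in (i) fails), and part (ii) is stated for n ≥ 2 only: K_{1,1} is a single edge adjacent to no edge, so it has no TDE-coloring and its total dominator edge chromatic number is undefined. *)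

theory Defs
  imports Main "HOL-Library.Extended_Nat"
begin

type_synonym 'a graph = "'a set \<times> 'a set set"

abbreviation verts :: "'a graph \<Rightarrow> 'a set" where "verts \<equiv> fst"
abbreviation edges :: "'a graph \<Rightarrow> 'a set set" where "edges \<equiv> snd"

definition simple_graph :: "'a graph \<Rightarrow> bool" where
  "simple_graph G \<longleftrightarrow> edges G \<subseteq> {{u, v} |u v. u \<in> verts G \<and> v \<in> verts G \<and> u \<noteq> v}"

definition complete_bipartite :: "nat \<Rightarrow> nat \<Rightarrow> (nat + nat) graph" where
  "complete_bipartite n m =
     ({..<n} <+> {..<m}, {{Inl i, Inr j} |i j. i < n \<and> j < m})"

lemma simple_graph_complete_bipartite: "simple_graph (complete_bipartite n m)"
  unfolding simple_graph_def complete_bipartite_def by fastforce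

definition adjacent_edges :: "'a set \<Rightarrow> 'a set \<Rightarrow> bool" where
  "adjacent_edges e f \<longleftrightarrow> e \<noteq> f \<and> e \<inter> f \<noteq> {}"

definition proper_edge_coloring :: "'a graph \<Rightarrow> ('a set \<Rightarrow> 'c) \<Rightarrow> bool" where
  "proper_edge_coloring G c \<longleftrightarrow>
     (\<forall>e \<in> edges G. \<forall>f \<in> edges G. adjacent_edges e f \<longrightarrow> c e \<noteq> c f)"

text \<open>Only used colors contribute, so every color class is nonempty.\<close>

definition color_classes :: "'a graph \<Rightarrow> ('a set \<Rightarrow> 'c) \<Rightarrow> 'a set set set" where
  "color_classes G c = {{e \<in> edges G. c e = k} |k. k \<in> c ` edges G}"

definition tde_coloring :: "'a graph \<Rightarrow> ('a set \<Rightarrow> 'c) \<Rightarrow> bool" where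
  "tde_coloring G c \<longleftrightarrow> proper_edge_coloring G c \<and>
     (\<forall>e \<in> edges G. \<exists>C \<in> color_classes G c. \<forall>f \<in> C. adjacent_edges e f)"

text \<open>
  The value is \<open>\<infinity>\<close> if there is no TDE-coloring with finitely many color classes; otherwise the
  infimum is attained and is the minimum. Colors in \<open>nat\<close> suffice for finitely many classes, and
  the finiteness condition is needed because \<open>card\<close> of an infinite set is \<open>0\<close>.
\<close>

definition tde_chromatic_number :: "'a graph \<Rightarrow> enat" where
  "tde_chromatic_number G =
     Inf {enat (card (color_classes G c)) |c :: 'a set \<Rightarrow> nat.
            tde_coloring G c \<and> finite (color_classes G c)}"

text \<open>
  An edge is not adjacent to itself, so a graph with an isolated edge has no TDE-coloring. Among
  the complete bipartite graphs with nonempty parts this concerns exactly \<open>K\<^sub>1\<^sub>,\<^sub>1\<close>.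
\<close>

lemma no_tde_coloring_K11: "\<not> tde_coloring (complete_bipartite 1 1) c"
  by (auto simp: tde_coloring_def color_classes_def complete_bipartite_def adjacent_edges_def)

lemma tde_chromatic_number_K11: "tde_chromatic_number (complete_bipartite 1 1) = \<infinity>"
  unfolding tde_chromatic_number_def by (simp only: no_tde_coloring_K11) (simp add: top_enat_def)

end

theory Submission
  imports Defs
begin

text \<open>
  Place the edges of \<open>K\<^sub>n\<^sub>,\<^sub>m\<close> in an \<open>n \<times> m\<close> grid, the edge \<open>{Inl i, Inr j}\<close> in the cell
  \<open>(i, j)\<close>. Two edges are adjacent when their cells share exactly one of row and column, so a
  proper edge coloring is a labelling of the grid without repetitions in a row or in a column.

  Lower bound: all edges at one vertex are pairwise adjacent, hence have different colors
  (\<open>card_clique_le_card_classes\<close>), and there are vertices of degree \<open>n\<close> and of degree \<open>m\<close>.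

  Upper bound: let \<open>n \<le> m\<close> and \<open>m \<ge> 2\<close>. Give the \<open>n\<close> cells of column \<open>0\<close> private colors, and label the
  other \<open>m - 1\<close> columns by a cyclic Latin rectangle, for which \<open>max n (m - 1)\<close> colors suffice.
  Every row then contains a singleton color class, in column \<open>0\<close>, which dominates the rest of
  the row, and the cells of column \<open>0\<close> dominate each other when \<open>n \<ge> 2\<close>;
  a single row is a star, in which all color classes are singletons
  (\<open>grid_tde_singleton_column\<close>). The number of colors is at most \<open>n + max n (m - 1)\<close>, that is,
  \<open>n + m - 1\<close> for \<open>n < m\<close> and \<open>2 n\<close> for \<open>n = m\<close>. The case \<open>n > m\<close> follows by transposing the
  grid.
\<close>

text \<open>Counting colors instead of classes makes images and injectivity available.\<close>

lemma card_color_classes: "card (color_classes G c) = card (c ` edges G)"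
  and finite_color_classes_iff: "finite (color_classes G c) \<longleftrightarrow> finite (c ` edges G)"
proof -
  let ?class = "\<lambda>k. {e \<in> edges G. c e = k}"
  have classes: "color_classes G c = ?class ` (c ` edges G)"
    unfolding color_classes_def by blast
  have inj: "inj_on ?class (c ` edges G)"
    by (rule inj_onI) blast
  show "card (color_classes G c) = card (c ` edges G)"
    unfolding classes by (rule card_image[OF inj])
  show "finite (color_classes G c) \<longleftrightarrow> finite (c ` edges G)"
    unfolding classes by (rule finite_image_iff[OF inj])
qed

lemma card_clique_le_card_classes:
  assumes "proper_edge_coloring G c" and "finite (color_classes G c)" and "A \<subseteq> edges G"
    and clique: "\<And>e f. e \<in> A \<Longrightarrow> f \<in> A \<Longrightarrow> e \<noteq> f \<Longrightarrow> adjacent_edges e f"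
  shows "card A \<le> card (color_classes G c)"
proof -
  have "inj_on c A"
    using assms unfolding proper_edge_coloring_def inj_on_def by blast
  then have "card A = card (c ` A)"
    by (simp add: card_image)
  also have "\<dots> \<le> card (c ` edges G)"
    using assms by (intro card_mono image_mono) (simp_all add: finite_color_classes_iff)
  finally show ?thesis
    by (simp add: card_color_classes)
qed

lemma card_clique_le_tde_chromatic_number:
  assumes "A \<subseteq> edges G"
    and "\<And>e f. e \<in> A \<Longrightarrow> f \<in> A \<Longrightarrow> e \<noteq> f \<Longrightarrow> adjacent_edges e f"
  shows "enat (card A) \<le> tde_chromatic_number G"
  unfolding tde_chromatic_number_def
proof (rule Inf_greatest)
  fix x
  assume "x \<in> {enat (card (color_classes G c)) |c :: 'a set \<Rightarrow> nat.
                 tde_coloring G c \<and> finite (color_classes G c)}"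
  then obtain c :: "'a set \<Rightarrow> nat" where x: "x = enat (card (color_classes G c))"
    and "tde_coloring G c" and fin: "finite (color_classes G c)"
    by blast
  then have "proper_edge_coloring G c"
    by (simp add: tde_coloring_def)
  from card_clique_le_card_classes[OF this fin assms]
  show "enat (card A) \<le> x"
    by (simp add: x)
qed

lemma edge_complete_bipartite [simp]:
  "{Inl i, Inr j} \<in> edges (complete_bipartite n m) \<longleftrightarrow> i < n \<and> j < m"
  by (simp add: complete_bipartite_def doubleton_eq_iff)

lemma max_le_tde_chromatic_number_complete_bipartite:
  assumes "n \<ge> 1" and "m \<ge> 1"
  shows "enat (max n m) \<le> tde_chromatic_number (complete_bipartite n m)"
proof -
  let ?row = "(\<lambda>j. {Inl 0, Inr j} :: (nat + nat) set) ` {..<m}"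
  let ?col = "(\<lambda>i. {Inl i, Inr 0} :: (nat + nat) set) ` {..<n}"
  have "enat (card ?row) \<le> tde_chromatic_number (complete_bipartite n m)"
    using assms by (intro card_clique_le_tde_chromatic_number)
      (auto simp: adjacent_edges_def)
  moreover have "card ?row = m"
    by (subst card_image) (auto simp: inj_on_def doubleton_eq_iff)
  moreover have "enat (card ?col) \<le> tde_chromatic_number (complete_bipartite n m)"
    using assms by (intro card_clique_le_tde_chromatic_number)
      (auto simp: adjacent_edges_def)
  moreover have "card ?col = n"
    by (subst card_image) (auto simp: inj_on_def doubleton_eq_iff)
  ultimately show ?thesis
    by (simp add: max_def)
qed

text \<open>
  A TDE-coloring of \<open>K\<^sub>n\<^sub>,\<^sub>m\<close> read as a labelling of the grid. A cell shares exactly one of row and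
  column with \<open>(i, j)\<close> when the two edges are adjacent, and the dominated color class is named by
  one of its cells \<open>(p, q)\<close>. Rows and columns enter symmetrically, so that one construction serves
  both \<open>n \<le> m\<close> and \<open>n > m\<close>.
\<close>

definition grid_tde :: "nat \<Rightarrow> nat \<Rightarrow> (nat \<Rightarrow> nat \<Rightarrow> 'c) \<Rightarrow> bool" where
  "grid_tde n m g \<longleftrightarrow>
     (\<forall>i<n. inj_on (g i) {..<m}) \<and> (\<forall>j<m. inj_on (\<lambda>i. g i j) {..<n}) \<and>
     (\<forall>i<n. \<forall>j<m. \<exists>p<n. \<exists>q<m. \<forall>a<n. \<forall>b<m. g a b = g p q \<longrightarrow> (a = i) \<noteq> (b = j))"

lemma grid_tde_transpose:
  assumes "grid_tde n m g"
  shows "grid_tde m n (\<lambda>j i. g i j)"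
proof -
  have "\<exists>q<m. \<exists>p<n. \<forall>b<m. \<forall>a<n. g a b = g p q \<longrightarrow> (b = j) \<noteq> (a = i)"
    if "i < n" "j < m" for i j
  proof -
    have "\<exists>p<n. \<exists>q<m. \<forall>a<n. \<forall>b<m. g a b = g p q \<longrightarrow> (a = i) \<noteq> (b = j)"
      using assms that by (simp only: grid_tde_def)
    then show ?thesis
      by blast
  qed
  with assms show ?thesis
    by (simp add: grid_tde_def)
qed

definition edge_coloring_of_grid :: "(nat \<Rightarrow> nat \<Rightarrow> 'c) \<Rightarrow> (nat + nat) set \<Rightarrow> 'c" where
  "edge_coloring_of_grid g e = g (THE i. Inl i \<in> e) (THE j. Inr j \<in> e)"

lemma edge_coloring_of_grid_edge [simp]: "edge_coloring_of_grid g {Inl i, Inr j} = g i j"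
  by (simp add: edge_coloring_of_grid_def)

lemma adjacent_edges_grid:
  "adjacent_edges {Inl i, Inr j :: nat + nat} {Inl a, Inr b} \<longleftrightarrow> (a = i) \<noteq> (b = j)"
  by (auto simp: adjacent_edges_def doubleton_eq_iff)

lemma tde_coloring_of_grid:
  assumes "grid_tde n m g"
  shows "tde_coloring (complete_bipartite n m) (edge_coloring_of_grid g)"
    (is "tde_coloring ?K ?c")
  unfolding tde_coloring_def
proof (intro conjI ballI)
  show "proper_edge_coloring ?K ?c"
    using assms unfolding proper_edge_coloring_def grid_tde_def inj_on_def
    by (auto simp: complete_bipartite_def adjacent_edges_grid)
next
  fix e
  assume "e \<in> edges ?K"
  then obtain i j where e: "e = {Inl i, Inr j}" "i < n" "j < m"
    by (auto simp: complete_bipartite_def)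
  have "\<exists>p<n. \<exists>q<m. \<forall>a<n. \<forall>b<m. g a b = g p q \<longrightarrow> (a = i) \<noteq> (b = j)"
    using assms e(2,3) by (simp only: grid_tde_def)
  then obtain p q where pq: "p < n" "q < m"
    and dom: "\<forall>a<n. \<forall>b<m. g a b = g p q \<longrightarrow> (a = i) \<noteq> (b = j)"
    by (elim exE conjE)
  let ?C = "{f \<in> edges ?K. ?c f = g p q}"
  have "{Inl p, Inr q} \<in> edges ?K"
    using pq by simp
  then have "g p q \<in> ?c ` edges ?K"
    by (metis edge_coloring_of_grid_edge imageI)
  then have "?C \<in> color_classes ?K ?c"
    unfolding color_classes_def by blast
  moreover have "\<forall>f\<in>?C. adjacent_edges e f"
    using dom by (auto simp: complete_bipartite_def e adjacent_edges_grid)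
  ultimately show "\<exists>C\<in>color_classes ?K ?c. \<forall>f\<in>C. adjacent_edges e f"
    by blast
qed

lemma tde_chromatic_number_le_grid:
  fixes g :: "nat \<Rightarrow> nat \<Rightarrow> nat"
  assumes "grid_tde n m g" and "\<And>i j. i < n \<Longrightarrow> j < m \<Longrightarrow> g i j < N"
  shows "tde_chromatic_number (complete_bipartite n m) \<le> enat N"
proof -
  let ?K = "complete_bipartite n m" and ?c = "edge_coloring_of_grid g"
  have colors: "?c ` edges ?K \<subseteq> {..<N}"
    using assms(2) by (auto simp: complete_bipartite_def)
  then have "finite (color_classes ?K ?c)"
    unfolding finite_color_classes_iff by (rule finite_subset) simp
  then have "tde_chromatic_number ?K \<le> enat (card (color_classes ?K ?c))"
    unfolding tde_chromatic_number_def
    using tde_coloring_of_grid[OF assms(1)] by (intro Inf_lower) blast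
  also have "card (color_classes ?K ?c) \<le> N"
    unfolding card_color_classes using card_mono[OF _ colors] by simp
  finally show ?thesis
    by simp
qed

text \<open>
  The labels of the cyclic Latin rectangle are smaller than \<open>k\<close>, so that the label \<open>k + i\<close> occurs
  only in the cell \<open>(i, 0)\<close>.
\<close>

definition singleton_column_grid :: "nat \<Rightarrow> nat \<Rightarrow> nat \<Rightarrow> nat" where
  "singleton_column_grid k i j = (if j = 0 then k + i else (i + j) mod k)"

lemma mod_shift_inj:
  fixes k s x y :: nat
  assumes "(s + x) mod k = (s + y) mod k" and "x < y + k" and "y < x + k"
  shows "x = y"
proof -
  have "int k dvd int x - int y"
    using assms(1) by (metis add_diff_cancel_left mod_eq_dvd_iff of_nat_add of_nat_mod)
  moreover have "\<bar>int x - int y\<bar> < int k"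
    using assms by linarith
  ultimately show ?thesis
    using zdvd_not_zless[of "\<bar>int x - int y\<bar>" "int k"] by fastforce
qed

text \<open>
  The Latin rectangle has \<open>n\<close> rows and \<open>m - 1\<close> columns, so addition modulo \<open>k\<close> does not repeat in
  a column if \<open>n \<le> k\<close>, nor in a row if \<open>m - 1 \<le> k\<close>. The edge of \<open>K\<^sub>1\<^sub>,\<^sub>1\<close> is isolated, whence
  \<open>m \<ge> 2\<close>.
\<close>

lemma grid_tde_singleton_column:
  assumes "n \<ge> 1" and "m \<ge> 2" and "n \<le> k" and "m - 1 \<le> k"
  shows "grid_tde n m (singleton_column_grid k)"
    (is "grid_tde n m ?g")
proof -
  have k: "k > 0"
    using assms by simp
  have once: "?g a b = ?g p 0 \<longleftrightarrow> a = p \<and> b = 0" for a b p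
    using mod_less_divisor[OF k, of "a + b"]
    by (auto simp: singleton_column_grid_def simp del: mod_less_divisor)
  have rows: "inj_on (?g i) {..<m}" for i
  proof (rule inj_onI)
    fix x y
    assume xy: "x \<in> {..<m}" "y \<in> {..<m}" "?g i x = ?g i y"
    show "x = y"
    proof (cases "x = 0 \<or> y = 0")
      case True
      then show ?thesis
        using xy(3) once by metis
    next
      case False
      then show ?thesis
        using xy assms(4) by (intro mod_shift_inj[of i x k y]) (auto simp: singleton_column_grid_def)
    qed
  qed
  have columns: "inj_on (\<lambda>i. ?g i j) {..<n}" for j
  proof (rule inj_onI)
    fix x y
    assume xy: "x \<in> {..<n}" "y \<in> {..<n}" "?g x j = ?g y j"
    show "x = y"
      using xy assms(3) mod_shift_inj[of j x k y]
      by (auto simp: singleton_column_grid_def add.commute split: if_splits)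
  qed
  have "\<exists>p<n. \<exists>q<m. \<forall>a<n. \<forall>b<m. ?g a b = ?g p q \<longrightarrow> (a = i) \<noteq> (b = j)"
    if "i < n" "j < m" for i j
  proof -
    consider "j \<noteq> 0" | "j = 0" "n \<ge> 2" | "j = 0" "n = 1"
      using assms(1) by linarith
    then show ?thesis
    proof cases
      case 1
      then show ?thesis
        using that once by (intro exI[of _ i] conjI exI[of _ 0]) auto
    next
      case 2
      obtain p where "p < n" "p \<noteq> i"
        using 2(2) that[of 0] that[of 1] by (cases "i = 0") auto
      then show ?thesis
        using \<open>j < m\<close> 2(1) once by (intro exI[of _ p] conjI exI[of _ 0]) auto
    next
      case 3
      \<comment> \<open>The edges form a star, so the singleton class of the cell \<open>(0, 1)\<close> is dominated.\<close>
      have "b = 1" if "b < m" "?g 0 b = ?g 0 1" for b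
        using inj_onD[OF rows that(2)] that(1) assms(2) by simp
      then show ?thesis
        using that 3 assms(2) by (intro exI[of _ 0] conjI exI[of _ 1]) auto
    qed
  qed
  with rows columns show ?thesis
    by (simp add: grid_tde_def)
qed

lemma singleton_column_grid_less:
  assumes "i < n" and "k \<ge> 1"
  shows "singleton_column_grid k i j < n + k"
  using assms mod_less_divisor[of k "i + j"]
  by (auto simp: singleton_column_grid_def simp del: mod_less_divisor)

lemma tde_chromatic_number_complete_bipartite_le:
  assumes "n \<ge> 1" and "m \<ge> 2"
  shows "tde_chromatic_number (complete_bipartite n m) \<le> enat (n + max n (m - 1))"
    and "tde_chromatic_number (complete_bipartite m n) \<le> enat (n + max n (m - 1))"
proof -
  let ?k = "max n (m - 1)"
  have grid: "grid_tde n m (singleton_column_grid ?k)"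
    using assms by (intro grid_tde_singleton_column) auto
  have bound: "singleton_column_grid ?k i j < n + ?k" if "i < n" for i j
    using that assms by (intro singleton_column_grid_less) auto
  show "tde_chromatic_number (complete_bipartite n m) \<le> enat (n + ?k)"
    using bound by (intro tde_chromatic_number_le_grid[OF grid])
  show "tde_chromatic_number (complete_bipartite m n) \<le> enat (n + ?k)"
    using bound by (intro tde_chromatic_number_le_grid[OF grid_tde_transpose[OF grid]])
qed

theorem theorem2p9:
  "(\<forall>n m :: nat. n \<ge> 1 \<longrightarrow> m \<ge> 1 \<longrightarrow> n \<noteq> m \<longrightarrow>
      enat (max n m) \<le> tde_chromatic_number (complete_bipartite n m) \<and>
      tde_chromatic_number (complete_bipartite n m) \<le> enat (m + n - 1)) \<and>
   (\<forall>n :: nat. n \<ge> 2 \<longrightarrow>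
      enat n \<le> tde_chromatic_number (complete_bipartite n n) \<and>
      tde_chromatic_number (complete_bipartite n n) \<le> enat (2 * n))"
proof (intro conjI allI impI)
  fix n m :: nat
  assume nm: "n \<ge> 1" "m \<ge> 1" "n \<noteq> m"
  show "enat (max n m) \<le> tde_chromatic_number (complete_bipartite n m)"
    using nm by (intro max_le_tde_chromatic_number_complete_bipartite)
  show "tde_chromatic_number (complete_bipartite n m) \<le> enat (m + n - 1)"
  proof (cases "n < m")
    case True
    moreover from True have "n + max n (m - 1) = m + n - 1"
      by auto
    ultimately show ?thesis
      using nm tde_chromatic_number_complete_bipartite_le(1)[of n m] by simp
  next
    case False
    with nm have "m < n"
      by simp
    moreover from this have "m + max m (n - 1) = m + n - 1"
      by auto
    ultimately show ?thesis
      using nm tde_chromatic_number_complete_bipartite_le(2)[of m n] by simp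
  qed
next
  fix n :: nat
  assume n: "n \<ge> 2"
  then show "enat n \<le> tde_chromatic_number (complete_bipartite n n)"
    using max_le_tde_chromatic_number_complete_bipartite[of n n] by simp
  have "n + max n (n - 1) = 2 * n"
    by simp
  with n show "tde_chromatic_number (complete_bipartite n n) \<le> enat (2 * n)"
    using tde_chromatic_number_complete_bipartite_le(1)[of n n] by (simp only:)
qed

end
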